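(* Let $L$ be a lattice with minimum $M$ and of full rank in the $n$-dimensional Euclidean space $E$. Let $S\subseteq L$ be a minimal generating system of $L$ consisting of vectors of norm at most $B\in\mathbb{R}$. Then $$|S|\leqslant n+\log_2\Bigl(n!\,\bigl(\tfrac{B}{M}\bigr)^n\Bigr).$$
   Context: $E$ is an $n$-dimensional Euclidean space with scalar product $(\cdot,\cdot)$, and the norm of $x\in E$ is the Euclidean norm $\|x\|=\sqrt{(x,x)}$. A lattice $L$ in $E$ has full rank, i.e. it spans $E$ over $\mathbb{R}$. The minimum of $L$ is $M=\min\{\|x\| : x\in L\setminus\{0\}\}$. A generating system is a set $S$ with $\langle S\rangle_{\mathbb{Z}}=L$, where $\langle S\rangle_{\mathbb{Z}}$ is the $\mathbb{Z}$-span. A generating system $S$ is called minimal if for every proper subset $S'\subsetneq S$ one has $\langle S'\rangle_{\mathbb{Z}}\subsetneq\langle S\rangle_{\mathbb{Z}}$. *)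

theory Defs
  imports "HOL-Analysis.Analysis"
begin

abbreviation int_scale :: "int \<Rightarrow> 'a::real_vector \<Rightarrow> 'a"
  where "int_scale k x \<equiv> of_int k *\<^sub>R x"

lemma module_int_scale: "module (int_scale :: int \<Rightarrow> 'a::real_vector \<Rightarrow> 'a)"
  by unfold_locales (simp_all add: algebra_simps)

definition int_span :: "'a::real_vector set \<Rightarrow> 'a set"
  where "int_span S = module.span int_scale S"

text \<open>The subspaces of a real vector space viewed as a module over the integers
  are exactly its additive subgroups.\<close>

definition is_lattice :: "'a::euclidean_space set \<Rightarrow> bool"
  where "is_lattice L \<longleftrightarrow> module.subspace int_scale L \<and> discrete L"

definition full_rank :: "'a::euclidean_space set \<Rightarrow> bool"
  where "full_rank L \<longleftrightarrow> span L = UNIV"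

text \<open>A nonzero lattice has a shortest nonzero vector, so the least element exists;
  on other sets the value is unspecified.\<close>

definition lattice_minimum :: "'a::euclidean_space set \<Rightarrow> real"
  where "lattice_minimum L = (LEAST r. r \<in> norm ` (L - {0}))"

definition generating_system :: "'a::real_vector set \<Rightarrow> 'a set \<Rightarrow> bool"
  where "generating_system S L \<longleftrightarrow> int_span S = L"

definition minimal_generating_system :: "'a::real_vector set \<Rightarrow> 'a set \<Rightarrow> bool"
  where "minimal_generating_system S L \<longleftrightarrow>
    generating_system S L \<and> (\<forall>S'. S' \<subset> S \<longrightarrow> int_span S' \<subset> int_span S)"

end

theory Submission
  imports Defs
begin

text \<open>Choose a real basis \<open>C \<subseteq> S\<close>. By minimality of \<open>S\<close>, the \<open>2 ^ card (S - C)\<close> subset sums of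
  \<open>S - C\<close> are pairwise incongruent modulo the \<open>\<int>\<close>-span of \<open>C\<close>. The orthogonal box whose sides are
  the Gram-Schmidt lengths of \<open>C\<close> covers the space under translation by the \<open>\<int>\<close>-span of \<open>C\<close> and
  has volume at most \<open>B ^ n\<close>. Since the balls of radius \<open>M/2\<close> around lattice points
  do not overlap, cutting the balls around the subset sums along the translated boxes and moving
  the pieces back into one box gives \<open>2 ^ card (S - C) * V * (M/2) ^ n \<le> B ^ n\<close>, where
  the volume \<open>V\<close> of the unit ball is at least \<open>2 ^ n / n!\<close>, the volume of the cross-polytope.\<close>

interpretation int_module: module int_scale
  by (rule module_int_scale)

section \<open>Lattice points in bounded sets and the minimum of a lattice\<close>

text \<open>Differences of lattice points are lattice points, so the isolation radius of 0 separates
  all of them: a discrete subgroup is uniformly discrete, and a bounded uniformly discrete set is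
  finite.\<close>

lemma finite_lattice_Int_bounded:
  fixes L :: "'a::euclidean_space set"
  assumes "is_lattice L" "bounded A"
  shows "finite (L \<inter> A)"
proof -
  have sub: "int_module.subspace L" and "discrete L"
    using assms by (auto simp: is_lattice_def)
  then have "0 isolated_in L"
    using int_module.subspace_0 discreteD by blast
  then obtain e where e: "e > 0" "\<And>y. y \<in> L \<Longrightarrow> dist 0 y < e \<Longrightarrow> y = 0"
    by (auto simp: isolated_in_dist_Ex_iff)
  have "uniform_discrete L"
    unfolding uniform_discrete_def
  proof (intro exI conjI ballI impI)
    fix x y assume "x \<in> L" "y \<in> L" "dist x y < e"
    then show "x = y"
      using e(2)[of "x - y"] int_module.subspace_diff[OF sub, of x y]
      by (simp add: dist_norm norm_minus_commute)
  qed fact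
  then show ?thesis
    using assms(2) by (meson uniform_discrete_finite_iff uniform_discrete_subset bounded_Int inf_le1)
qed

text \<open>\<open>LEAST\<close> on reals says nothing until a least element is exhibited. For a
  nonzero lattice vector \<open>v\<close>, only finitely many lattice points have norm at most
  \<open>norm v\<close>, so the minimum is attained among them.\<close>

lemma lattice_minimum_le_norm:
  fixes L :: "'a::euclidean_space set"
  assumes "is_lattice L" "L - {0} \<noteq> {}"
  shows "0 < lattice_minimum L" "\<And>x. x \<in> L \<Longrightarrow> x \<noteq> 0 \<Longrightarrow> lattice_minimum L \<le> norm x"
proof -
  obtain v where v: "v \<in> L" "v \<noteq> 0"
    using assms(2) by auto
  define F where "F = norm ` (L \<inter> cball 0 (norm v) - {0})"
  have F: "finite F" "norm v \<in> F"
    using finite_lattice_Int_bounded[OF assms(1), of "cball 0 (norm v)"] v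
    by (auto simp: F_def)
  have le: "Min F \<le> norm x" if "x \<in> L" "x \<noteq> 0" for x
  proof (cases "norm x \<le> norm v")
    case True
    then have "norm x \<in> F"
      using that by (auto simp: F_def)
    then show ?thesis
      using F by simp
  next
    case False
    then show ?thesis
      using Min_le[OF F] by linarith
  qed
  have mem: "Min F \<in> F"
    using F by (intro Min_in) auto
  have eq: "lattice_minimum L = Min F"
    unfolding lattice_minimum_def
    by (rule Least_equality) (use mem le in \<open>auto simp: F_def\<close>)
  show "0 < lattice_minimum L"
    using mem by (auto simp: eq F_def)
  show "\<And>x. x \<in> L \<Longrightarrow> x \<noteq> 0 \<Longrightarrow> lattice_minimum L \<le> norm x"
    using le by (simp add: eq)
qed

section \<open>Volume of the unit ball and packing of balls\<close>

text \<open>No cross-polytope is measured: the bound is read off the closed formulas for even and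
  odd dimension, using only \<open>2 \<le> pi\<close> and
  \<open>fact k * 2 ^ k \<le> fact (2 * k)\<close>.\<close>

lemma unit_ball_vol_ge: "2 ^ n / fact n \<le> unit_ball_vol (real n)"
proof -
  have pi: "1 \<le> pi ^ k" "2 ^ k \<le> pi ^ k" for k
    using pi_ge_two by (auto intro!: one_le_power power_mono)
  have fact_sq: "(fact k * 2 ^ k :: real) \<le> fact (2 * k)" for k
  proof (induction k)
    case (Suc k)
    have "(fact (Suc k) * 2 ^ Suc k :: real) = (2 * real k + 2) * (fact k * 2 ^ k)"
      by (simp add: algebra_simps)
    also have "\<dots> \<le> (2 * real k + 2) * ((2 * real k + 1) * fact (2 * k))"
    proof (rule mult_left_mono)
      have "fact (2 * k) * 1 \<le> fact (2 * k) * (2 * real k + 1)"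
        by (rule mult_left_mono) auto
      then show "fact k * 2 ^ k \<le> (2 * real k + 1) * fact (2 * k)"
        using Suc by (simp only: mult.commute mult_1_right)
    qed simp
    also have "\<dots> = fact (2 * Suc k)"
      by (simp add: algebra_simps)
    finally show ?case .
  qed simp
  show ?thesis
  proof (cases "even n")
    case True
    then obtain k where n: "n = 2 * k" ..
    have "(2 ^ n * fact k :: real) = 2 ^ k * (fact k * 2 ^ k)"
      by (simp add: n mult_2 power_add)
    also have "\<dots> \<le> pi ^ k * fact (2 * k)"
      by (intro mult_mono fact_sq pi) auto
    finally show ?thesis
      unfolding n unit_ball_vol_even by (simp add: n field_simps)
  next
    case False
    then obtain k where n: "n = 2 * k + 1" by (rule oddE)
    have "1 \<le> fact k * pi ^ k"
      using mult_mono[of 1 "fact k" 1 "pi ^ k"] pi by simp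
    then have "2 ^ n * (1::real) \<le> 2 ^ n * (fact k * pi ^ k)"
      by (intro mult_left_mono) auto
    moreover have "unit_ball_vol (real n) = 2 ^ n * (fact k * pi ^ k) / fact n"
    proof -
      \<comment> \<open>The odd formula has \<open>fact (Suc k)\<close> over
        \<open>fact (2 * Suc k)\<close>; with \<open>a = 1 + real k\<close> the common factor
        \<open>2 * a\<close> cancels.\<close>
      obtain a where a: "a = 1 + real k" "a \<noteq> 0"
        by (metis add.commute of_nat_Suc of_nat_neq_0)
      have "(fact (2 * Suc k) :: real) = 2 * a * fact n"
        "(fact (Suc k) :: real) = a * fact k" "(2 ^ (2 * Suc k) :: real) = 2 * 2 ^ n"
        by (simp_all add: n a(1) algebra_simps)
      then have "unit_ball_vol (real n) = 2 * 2 ^ n * (a * fact k) / (2 * a * fact n) * pi ^ k"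
        using unit_ball_vol_odd[of k, folded n] by (simp only:)
      then show ?thesis
        using a(2) by simp
    qed
    ultimately show ?thesis
      by (simp add: divide_right_mono)
  qed
qed

text \<open>Translation by \<open>-l\<close> moves the part of the ball at \<open>p\<close> inside
  \<open>l + Q\<close> to a part of the ball at \<open>p - l\<close> inside \<open>Q\<close>. By
  \<open>sep\<close> the moved parts are disjoint, so all the balls together have at most the volume
  of \<open>Q\<close>.\<close>

lemma measure_ball_packing:
  fixes P G Q :: "'a::euclidean_space set"
  assumes fin: "finite P" "finite G" and Q: "Q \<in> lmeasurable" and r: "0 \<le> r"
    and cover: "\<And>p. p \<in> P \<Longrightarrow> ball p r \<subseteq> (\<Union>l\<in>G. (+) l ` Q)"
    and sep: "\<And>p l p' l'. \<lbrakk>p \<in> P; l \<in> G; p' \<in> P; l' \<in> G; (p, l) \<noteq> (p', l')\<rbrakk>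
                \<Longrightarrow> 2 * r \<le> dist (p - l) (p' - l')"
  shows "card P * (unit_ball_vol (real DIM('a)) * r ^ DIM('a)) \<le> measure lebesgue Q"
proof -
  let ?\<mu> = "measure (lebesgue :: 'a measure)"
  let ?F = "\<lambda>(p, l). ball (p - l) r \<inter> Q"
  have piece: "?\<mu> (ball p r \<inter> (+) l ` Q) = ?\<mu> (ball (p - l) r \<inter> Q)" for p l :: 'a
  proof -
    have "ball p r \<inter> (+) l ` Q = (+) l ` (ball (p - l) r \<inter> Q)"
      by (auto simp: dist_norm algebra_simps)
    then show ?thesis
      by (simp add: measure_translation)
  qed
  have "card P * (unit_ball_vol (real DIM('a)) * r ^ DIM('a)) = (\<Sum>p\<in>P. ?\<mu> (ball p r))"
    using r by (simp add: content_ball)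
  \<comment> \<open>Subadditivity is enough here, so the translates of \<open>Q\<close> may overlap
    and \<open>Q\<close> can be a closed box.\<close>
  also have "\<dots> \<le> (\<Sum>p\<in>P. \<Sum>l\<in>G. ?\<mu> (ball p r \<inter> (+) l ` Q))"
  proof (rule sum_mono)
    fix p assume p: "p \<in> P"
    have "ball p r = (\<Union>l\<in>G. ball p r \<inter> (+) l ` Q)"
      using cover[OF p] by blast
    then have "?\<mu> (ball p r) = ?\<mu> (\<Union>l\<in>G. ball p r \<inter> (+) l ` Q)"
      by simp
    also have "\<dots> \<le> (\<Sum>l\<in>G. ?\<mu> (ball p r \<inter> (+) l ` Q))"
      by (rule measure_UNION_le)
        (use fin Q in \<open>auto intro!: fmeasurableD fmeasurable.Int measurable_translation\<close>)
    finally show "?\<mu> (ball p r) \<le> (\<Sum>l\<in>G. ?\<mu> (ball p r \<inter> (+) l ` Q))" .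
  qed
  also have "\<dots> = (\<Sum>z\<in>P \<times> G. ?\<mu> (?F z))"
    by (simp add: piece sum.cartesian_product case_prod_unfold)
  also have "\<dots> = ?\<mu> (\<Union>z\<in>P \<times> G. ?F z)"
  proof (rule measure_UNION'[symmetric])
    show "pairwise (\<lambda>i j. disjnt (?F i) (?F j)) (P \<times> G)"
    proof (rule pairwiseI)
      fix i j assume "i \<in> P \<times> G" "j \<in> P \<times> G" "i \<noteq> j"
      then obtain p l p' l' where ij: "i = (p, l)" "j = (p', l')"
        and "2 * r \<le> dist (p - l) (p' - l')"
        using sep by (metis SigmaE)
      \<comment> \<open>Open balls are disjoint even when their centres are exactly
        \<open>2 * r\<close> apart.\<close>
      then have "\<not> (dist (p - l) x < r \<and> dist (p' - l') x < r)" for x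
        using dist_triangle2[of "p - l" "p' - l'" x] by linarith
      then show "disjnt (?F i) (?F j)"
        by (auto simp: ij disjnt_iff)
    qed
  qed (use fin Q in \<open>auto intro!: fmeasurable.Int\<close>)
  also have "\<dots> \<le> ?\<mu> Q"
    by (rule measure_mono_fmeasurable)
      (use fin Q in \<open>auto intro!: sets.finite_UN fmeasurableD[OF fmeasurable.Int]\<close>)
  finally show ?thesis .
qed

section \<open>Gram-Schmidt frames and reduction into a box\<close>

text \<open>\<open>d c\<close> is the length of the component of \<open>c\<close> orthogonal to the
  vectors inserted before it. Reduction runs backwards: only the vector inserted last has a
  component along the last direction of the frame, so its integer multiple is fixed first and later
  corrections do not disturb that coordinate.\<close>

lemma Gram_Schmidt_reduction:
  fixes C :: "'a::euclidean_space set"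
  assumes "finite C" "independent C"
  shows "\<exists>e d. (\<forall>a\<in>C. \<forall>b\<in>C. e a \<bullet> e b = (if a = b then 1 else 0)) \<and> span (e ` C) = span C \<and>
           (\<forall>c\<in>C. 0 < d c \<and> d c \<le> norm c) \<and>
           (\<forall>x\<in>span C. \<exists>l\<in>int_span C. \<forall>c\<in>C. 0 \<le> (x - l) \<bullet> e c \<and> (x - l) \<bullet> e c \<le> d c)"
  using assms
proof (induction C)
  case empty
  show ?case by (auto simp: int_span_def)
next
  case (insert v C)
  then have ind: "independent C" and v: "v \<notin> span C"
    by (auto simp: independent_insert)
  obtain e d where
    on: "\<And>a b. a \<in> C \<Longrightarrow> b \<in> C \<Longrightarrow> e a \<bullet> e b = (if a = b then 1 else 0)"
    and sp: "span (e ` C) = span C"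
    and d: "\<And>c. c \<in> C \<Longrightarrow> 0 < d c \<and> d c \<le> norm c"
    and red: "\<And>x. x \<in> span C \<Longrightarrow>
        \<exists>l\<in>int_span C. \<forall>c\<in>C. 0 \<le> (x - l) \<bullet> e c \<and> (x - l) \<bullet> e c \<le> d c"
    using insert.IH[OF ind] by blast
  obtain p q where p: "p \<in> span C" and q: "\<And>w. w \<in> span C \<Longrightarrow> q \<bullet> w = 0" and vpq: "v = p + q"
    using orthogonal_subspace_decomp_exists[of C v] by (metis orthogonal_def)
  have "q \<noteq> 0"
    using v p vpq by auto
  define u where "u = q /\<^sub>R norm q"
  have uu: "u \<bullet> u = 1" and uC: "\<And>w. w \<in> span C \<Longrightarrow> u \<bullet> w = 0"
    using \<open>q \<noteq> 0\<close> q by (auto simp: u_def dot_square_norm power2_eq_square)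
  have qu: "q = norm q *\<^sub>R u"
    using \<open>q \<noteq> 0\<close> by (simp add: u_def)
  have eC: "e c \<in> span C" if "c \<in> C" for c
    using sp that span_base[of "e c" "e ` C"] by auto
  define e' where "e' = e(v := u)"
  define d' where "d' = d(v := norm q)"
  have vC: "v \<notin> C" by fact
  then have e'C: "e' c = e c" "d' c = d c" if "c \<in> C" for c
    using that by (auto simp: e'_def d'_def)
  have e'v: "e' v = u" "d' v = norm q"
    by (auto simp: e'_def d'_def)
  have on': "e' a \<bullet> e' b = (if a = b then 1 else 0)" if "a \<in> insert v C" "b \<in> insert v C" for a b
    using that vC on uu uC[OF eC] by (auto simp: e'C e'v inner_commute)
  have "norm v ^ 2 = norm p ^ 2 + norm q ^ 2"
    using q[OF p] by (simp add: vpq norm_add_Pythagorean orthogonal_def inner_commute)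
  then have "norm q \<le> norm v"
    by (simp add: power2_le_imp_le)
  then have d'': "0 < d' c \<and> d' c \<le> norm c" if "c \<in> insert v C" for c
    using that d \<open>q \<noteq> 0\<close> vC by (auto simp: e'C e'v)
  have im: "e' ` insert v C = insert u (e ` C)"
    using e'C e'v by auto
  have "v \<in> span (insert u (e ` C))"
    unfolding span_breakdown_eq sp using p vpq qu
    by (intro exI[of _ "norm q"]) (metis add_diff_cancel_right')
  moreover have "u \<in> span (insert v C)"
  proof -
    have "q \<in> span (insert v C)"
      using p span_mono[of C "insert v C"] span_base[of v "insert v C"] vpq
      by (metis add_diff_cancel_left' insertI1 span_diff subsetD subset_insertI)
    then show ?thesis
      by (simp add: u_def span_scale)
  qed
  moreover have "C \<subseteq> span (insert u (e ` C))" "e ` C \<subseteq> span (insert v C)"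
    using sp span_superset[of C] span_superset[of "e ` C"]
      span_mono[of "e ` C" "insert u (e ` C)"] span_mono[of C "insert v C"] by blast+
  ultimately have sp': "span (e' ` insert v C) = span (insert v C)"
    unfolding im by (subst span_eq) auto
  have red': "\<exists>l\<in>int_span (insert v C). \<forall>c\<in>insert v C. 0 \<le> (x - l) \<bullet> e' c \<and> (x - l) \<bullet> e' c \<le> d' c"
    if x: "x \<in> span (insert v C)" for x
  proof -
    \<comment> \<open>As \<open>v \<bullet> u = norm q\<close>, subtracting \<open>k\<close> copies
      of \<open>v\<close> brings the coordinate along \<open>u\<close> to the remainder
      \<open>t\<close> between 0 and \<open>norm q\<close>.\<close>
    define k where "k = \<lfloor>(x \<bullet> u) / norm q\<rfloor>"
    define t where "t = x \<bullet> u - of_int k * norm q"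
    have "of_int k \<le> (x \<bullet> u) / norm q" "(x \<bullet> u) / norm q < of_int k + 1"
      by (auto simp: k_def)
    then have t: "0 \<le> t" "t \<le> norm q"
      using \<open>q \<noteq> 0\<close> by (auto simp: t_def field_simps)
    define y where "y = x - of_int k *\<^sub>R v - t *\<^sub>R u"
    have pu: "p \<bullet> u = 0"
      using uC[OF p] by (simp add: inner_commute)
    have "q \<bullet> u = norm q"
      by (subst qu) (simp add: uu)
    then have yu: "y \<bullet> u = 0"
      by (simp add: y_def t_def inner_diff_left vpq inner_add_left pu uu)
    obtain s where s: "x - s *\<^sub>R v \<in> span C"
      using x by (auto simp: span_breakdown_eq)
    \<comment> \<open>\<open>y\<close> differs from \<open>z\<close> in \<open>span C\<close> by a
      multiple of \<open>u\<close>. Since \<open>y\<close> is orthogonal to \<open>u\<close>, this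
      multiple vanishes and the induction hypothesis applies to \<open>y\<close>.\<close>
    define z where "z = x - s *\<^sub>R v + (s - of_int k) *\<^sub>R p"
    have z: "z \<in> span C"
      unfolding z_def using s p by (intro span_add span_scale)
    define a where "a = (s - of_int k) * norm q - t"
    have yz: "y = z + a *\<^sub>R u"
    proof -
      have "y = z + ((s - of_int k) *\<^sub>R q - t *\<^sub>R u)"
        by (simp add: y_def z_def vpq algebra_simps)
      also have "(s - of_int k) *\<^sub>R q - t *\<^sub>R u = a *\<^sub>R u"
        by (subst qu) (simp add: a_def algebra_simps)
      finally show ?thesis .
    qed
    then have "a = 0"
      using yu uC[OF z] uu by (simp add: inner_add_left inner_commute[of z u])
    then have y: "y \<in> span C"
      using yz z by simp
    obtain l where l: "l \<in> int_span C" "\<And>c. c \<in> C \<Longrightarrow> 0 \<le> (y - l) \<bullet> e c \<and> (y - l) \<bullet> e c \<le> d c"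
      using red[OF y] by blast
    have "int_span C \<subseteq> span C"
      unfolding int_span_def
      by (rule int_module.span_minimal)
        (auto simp: span_superset int_module.subspace_def span_zero span_add span_scale)
    then have lu: "l \<bullet> u = 0"
      using uC[of l] l by (auto simp: inner_commute)
    show ?thesis
    proof (intro bexI ballI)
      show "of_int k *\<^sub>R v + l \<in> int_span (insert v C)"
        using l(1) int_module.span_mono[OF subset_insertI[of C v]] unfolding int_span_def
        by (blast intro: int_module.span_add int_module.span_scale int_module.span_base)
    next
      fix c assume c: "c \<in> insert v C"
      \<comment> \<open>\<open>y - l\<close> carries the coordinates along the old frame and is
        orthogonal to \<open>u\<close>; \<open>t *\<^sub>R u\<close> carries only the new
        one.\<close>
      have eq: "x - (of_int k *\<^sub>R v + l) = (y - l) + t *\<^sub>R u"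
        by (simp add: y_def)
      show "0 \<le> (x - (of_int k *\<^sub>R v + l)) \<bullet> e' c \<and> (x - (of_int k *\<^sub>R v + l)) \<bullet> e' c \<le> d' c"
      proof (cases "c = v")
        case True
        then show ?thesis
          unfolding eq using t yu lu uu by (simp add: e'v inner_add_left inner_diff_left)
      next
        case False
        then have "c \<in> C" using c by simp
        then show ?thesis
          unfolding eq using l(2) uC[OF eC] by (simp add: e'C inner_add_left)
      qed
    qed
  qed
  show ?case
    by (intro exI[of _ e'] exI[of _ d'] conjI ballI on' sp' red' d''[THEN conjunct1] d''[THEN conjunct2])
qed

text \<open>A \<open>cbox\<close> is aligned with \<open>Basis\<close>. An isometry carrying the
  frame \<open>e\<close> to \<open>Basis\<close> turns the Gram-Schmidt box into a
  \<open>cbox\<close> of known content. That norms are preserved is Parseval's identity.\<close>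

lemma orthonormal_frame_isometry:
  fixes e :: "'b \<Rightarrow> 'a::euclidean_space"
  assumes "finite C" "card C = DIM('a)"
    and on: "\<And>a b. a \<in> C \<Longrightarrow> b \<in> C \<Longrightarrow> e a \<bullet> e b = (if a = b then 1 else 0)"
    and sp: "span (e ` C) = UNIV"
  obtains f :: "'a \<Rightarrow> 'a" and g where "linear f" "\<And>x. norm (f x) = norm x"
    "bij_betw g C Basis" "\<And>x c. c \<in> C \<Longrightarrow> f x \<bullet> g c = x \<bullet> e c"
proof -
  obtain g :: "'b \<Rightarrow> 'a" where g: "bij_betw g C Basis"
    using assms finite_same_card_bij[of C "Basis :: 'a set"] by auto
  define f where "f x = (\<Sum>c\<in>C. (x \<bullet> e c) *\<^sub>R g c)" for x
  have lin: "linear f"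
    unfolding f_def
    by (intro linearI) (auto simp: inner_add_left scaleR_add_left sum.distrib scaleR_sum_right)
  have coord: "f x \<bullet> g c = x \<bullet> e c" if c: "c \<in> C" for x c
  proof -
    have "g a \<bullet> g c = (if a = c then 1 else 0)" if "a \<in> C" for a
      using that c g inner_Basis[of "g a" "g c"] bij_betw_apply[OF g]
      by (auto simp: bij_betw_def inj_on_def)
    then have "f x \<bullet> g c = (\<Sum>a\<in>C. if a = c then x \<bullet> e a else 0)"
      unfolding f_def inner_sum_left by (intro sum.cong) auto
    then show ?thesis
      using c assms(1) by simp
  qed
  have inj: "inj_on e C"
    by (rule inj_onI) (metis on zero_neq_one)
  have expand: "x = (\<Sum>c\<in>C. (x \<bullet> e c) *\<^sub>R e c)" for x
  proof -
    have "(\<Sum>i\<in>e ` C. (x \<bullet> i) *\<^sub>R i) = x"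
      by (rule orthonormal_basis_expand)
        (use on sp assms(1) in \<open>auto simp: pairwise_def orthogonal_def norm_eq_1\<close>)
    then show ?thesis
      by (simp add: sum.reindex[OF inj])
  qed
  have "f x \<bullet> f x = x \<bullet> x" for x
  proof -
    have "f x \<bullet> f x = (\<Sum>b\<in>Basis. (f x \<bullet> b) * (f x \<bullet> b))"
      by (rule euclidean_inner)
    also have "\<dots> = (\<Sum>c\<in>C. (f x \<bullet> g c) * (f x \<bullet> g c))"
      by (rule sum.reindex_bij_betw[OF g, symmetric])
    also have "\<dots> = (\<Sum>c\<in>C. (x \<bullet> e c) * (x \<bullet> e c))"
      by (simp add: coord)
    also have "\<dots> = x \<bullet> (\<Sum>c\<in>C. (x \<bullet> e c) *\<^sub>R e c)"
      by (simp add: inner_sum_right)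
    finally show ?thesis
      using expand[of x] by simp
  qed
  then have "norm (f x) = norm x" for x
    by (simp add: norm_eq)
  with lin g coord that show ?thesis by blast
qed

section \<open>Counting lattice points modulo the integer span of a basis\<close>

text \<open>In the coordinates given by \<open>f\<close>, \<open>measure_ball_packing\<close> is
  applied to balls of radius \<open>M / 2\<close> and to the box with sides \<open>d c\<close>, each
  at most \<open>B\<close>. Incongruence keeps the centres of the moved pieces distinct, and
  distinct lattice points are at least \<open>M\<close> apart.\<close>

lemma incongruent_card_bound:
  fixes L C P :: "'a::euclidean_space set"
  assumes L: "is_lattice L" and M: "0 < M" "\<And>x. x \<in> L \<Longrightarrow> x \<noteq> 0 \<Longrightarrow> M \<le> norm x"
    and C: "C \<subseteq> L" "independent C" "span C = UNIV" "\<And>c. c \<in> C \<Longrightarrow> norm c \<le> B"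
    and P: "finite P" "P \<subseteq> L"
    and incong: "\<And>p q. p \<in> P \<Longrightarrow> q \<in> P \<Longrightarrow> p - q \<in> int_span C \<Longrightarrow> p = q"
  shows "card P * (unit_ball_vol (real DIM('a)) * (M / 2) ^ DIM('a)) \<le> B ^ DIM('a)"
proof -
  have fC: "finite C"
    using C(2) by (rule independent_imp_finite)
  have cC: "card C = DIM('a)"
    using C(2,3) by (metis basis_card_eq_dim dim_UNIV span_UNIV dim_eq_card)
  have subL: "int_module.subspace L"
    using L by (simp add: is_lattice_def)
  have spL: "int_span C \<subseteq> L"
    unfolding int_span_def using C(1) subL by (rule int_module.span_minimal)
  obtain e d where
    on: "\<And>a b. a \<in> C \<Longrightarrow> b \<in> C \<Longrightarrow> e a \<bullet> e b = (if a = b then 1 else 0)"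
    and sp: "span (e ` C) = UNIV"
    and d: "\<And>c. c \<in> C \<Longrightarrow> 0 < d c \<and> d c \<le> norm c"
    and red: "\<And>x. \<exists>l\<in>int_span C. \<forall>c\<in>C. 0 \<le> (x - l) \<bullet> e c \<and> (x - l) \<bullet> e c \<le> d c"
    using Gram_Schmidt_reduction[OF fC C(2)] C(3) unfolding C(3) by blast
  obtain f :: "'a \<Rightarrow> 'a" and g where f: "linear f" "\<And>x. norm (f x) = norm x"
    and g: "bij_betw g C Basis" and coord: "\<And>x c. c \<in> C \<Longrightarrow> f x \<bullet> g c = x \<bullet> e c"
    using orthonormal_frame_isometry[OF fC cC on sp] by blast
  have injf: "inj f"
    using f by (metis linear_injective_0 norm_eq_zero)
  then have surjf: "surj f"
    using f(1) linear_injective_imp_surjective by blast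
  have fdiff: "f (x - y) = f x - f y" for x y
    using f(1) by (rule linear_diff)
  \<comment> \<open>\<open>D\<close> is the corner opposite the origin, so \<open>f\<close> maps a
    vector into \<open>cbox 0 D\<close> exactly when the vector is reduced.\<close>
  define D where "D = (\<Sum>c\<in>C. d c *\<^sub>R g c)"
  have Dg: "D \<bullet> g c = d c" if c: "c \<in> C" for c
  proof -
    have "g a \<bullet> g c = (if a = c then 1 else 0)" if "a \<in> C" for a
      using that c g inner_Basis[of "g a" "g c"] bij_betw_apply[OF g]
      by (auto simp: bij_betw_def inj_on_def)
    then have "D \<bullet> g c = (\<Sum>a\<in>C. if a = c then d a else 0)"
      unfolding D_def inner_sum_left by (intro sum.cong) auto
    then show ?thesis
      using c fC by simp
  qed
  have Basis_g: "\<exists>c\<in>C. b = g c" if "b \<in> Basis" for b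
    using that g by (auto simp: bij_betw_def)
  define Q where "Q = cbox 0 D"
  have Q_iff: "f x \<in> Q \<longleftrightarrow> (\<forall>c\<in>C. 0 \<le> x \<bullet> e c \<and> x \<bullet> e c \<le> d c)" for x
    unfolding Q_def mem_box bij_betw_imp_surj_on[OF g, symmetric] by (simp add: coord Dg)
  have measQ: "measure lebesgue Q \<le> B ^ DIM('a)"
  proof -
    have "measure lebesgue Q = (\<Prod>b\<in>Basis. D \<bullet> b)"
      unfolding Q_def using Basis_g Dg d
      by (subst measure_completion, simp, subst content_cbox) (force intro: less_imp_le)+
    also have "\<dots> = (\<Prod>c\<in>C. D \<bullet> g c)"
      by (rule prod.reindex_bij_betw[OF g, symmetric])
    also have "\<dots> = (\<Prod>c\<in>C. d c)"
      by (simp add: Dg)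
    also have "\<dots> \<le> (\<Prod>c\<in>C. B)"
      by (rule prod_mono) (use d C(4) in \<open>force intro: less_imp_le order_trans\<close>)
    finally show ?thesis
      by (simp add: cC)
  qed
  \<comment> \<open>The packing needs finitely many translations. If \<open>x\<close> is within
    \<open>M / 2\<close> of \<open>p\<close> and \<open>f (x - l)\<close> lies in the box, then
    \<open>norm l\<close> is at most \<open>norm p + M / 2 + norm D\<close>; the sum bounds every
    \<open>norm p\<close> at once.\<close>
  define R where "R = M + (\<Sum>p\<in>P. norm p) + norm D"
  define H where "H = int_span C \<inter> cball 0 R"
  have "finite (L \<inter> cball 0 R)"
    using finite_lattice_Int_bounded[OF L] by blast
  then have finH: "finite H"
    unfolding H_def by (rule rev_finite_subset) (use spL in blast)
  have card_fP: "card (f ` P) = card P"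
    using injf by (metis card_image inj_on_subset subset_UNIV)
  have "card (f ` P) * (unit_ball_vol (real DIM('a)) * (M / 2) ^ DIM('a)) \<le> measure lebesgue Q"
  proof (rule measure_ball_packing[where G = "f ` H"])
    show "finite (f ` P)" "finite (f ` H)" "Q \<in> lmeasurable" "0 \<le> M / 2"
      using P finH M(1) by (auto simp: Q_def)
  next
    fix p' assume "p' \<in> f ` P"
    then obtain p where p: "p \<in> P" "p' = f p" by auto
    show "ball p' (M / 2) \<subseteq> (\<Union>l\<in>f ` H. (+) l ` Q)"
    proof
      fix y assume "y \<in> ball p' (M / 2)"
      then obtain x where x: "y = f x" "norm (p - x) < M / 2"
        using surjf p f by (metis fdiff dist_norm mem_ball surjD)
      obtain l where l: "l \<in> int_span C" "f (x - l) \<in> Q"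
        using red[of x] by (auto simp: Q_iff)
      have "norm (x - l) \<le> norm D"
      proof -
        have "norm (f (x - l)) \<le> norm D"
          using l(2) unfolding Q_def
          by (intro norm_le_componentwise) (force simp: mem_box)
        then show ?thesis by (simp add: f)
      qed
      moreover have "norm p \<le> (\<Sum>p\<in>P. norm p)"
        using P p by (intro member_le_sum) auto
      moreover have "norm l \<le> norm p + norm (p - x) + norm (x - l)"
        using norm_triangle_ineq4[of p "p - x"] norm_triangle_ineq4[of x "x - l"] by simp
      ultimately have "l \<in> H"
        using l x M(1) by (simp add: H_def R_def)
      moreover have "y = f l + f (x - l)"
        by (simp add: x fdiff)
      ultimately show "y \<in> (\<Union>l\<in>f ` H. (+) l ` Q)"
        using l by blast
    qed
  next
    fix p' l' q' k'
    assume "p' \<in> f ` P" "l' \<in> f ` H" "q' \<in> f ` P" "k' \<in> f ` H" and ne: "(p', l') \<noteq> (q', k')"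
    then obtain p l q k where pq: "p \<in> P" "q \<in> P" "l \<in> H" "k \<in> H"
      and eqs: "p' = f p" "l' = f l" "q' = f q" "k' = f k"
      by auto
    \<comment> \<open>\<open>z\<close> is a lattice vector. If it were 0, \<open>p\<close> and
      \<open>q\<close> would be congruent, hence equal, and then \<open>l = k\<close>.\<close>
    define z where "z = (p - l) - (q - k)"
    have lk: "l \<in> int_span C" "k \<in> int_span C"
      using pq by (auto simp: H_def)
    have "z \<in> L"
      unfolding z_def using pq P lk spL by (intro int_module.subspace_diff[OF subL]) auto
    moreover have "z \<noteq> 0"
    proof
      assume "z = 0"
      then have "p - q = l - k"
        by (simp add: z_def algebra_simps)
      moreover have "l - k \<in> int_span C"
        using lk by (simp add: int_span_def int_module.span_diff)
      ultimately have "p = q"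
        using incong[OF pq(1,2)] by simp
      moreover from this have "l = k"
        using \<open>p - q = l - k\<close> by simp
      ultimately show False
        using ne by (simp add: eqs)
    qed
    ultimately have "M \<le> norm z"
      by (rule M)
    also have "norm z = norm (f z)"
      by (simp add: f)
    also have "f z = (p' - l') - (q' - k')"
      by (simp add: z_def fdiff eqs)
    finally show "2 * (M / 2) \<le> dist (p' - l') (q' - k')"
      by (simp add: dist_norm)
  qed
  then show ?thesis
    using measQ by (simp add: card_fP)
qed

section \<open>Minimal generating systems and the final estimate\<close>

text \<open>An element \<open>x\<close> of \<open>T\<close> outside \<open>U\<close> occurs in the
  congruence with coefficient 1. Solving for \<open>x\<close> puts it into the integer span of
  \<open>S - {x}\<close>, against minimality.\<close>

lemma subset_sums_incongruent:
  fixes S C T U :: "'a::real_vector set"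
  assumes S: "minimal_generating_system S L" and C: "C \<subseteq> S" "finite (S - C)"
    and T: "T \<subseteq> S - C" and U: "U \<subseteq> S - C" and TU: "\<Sum>T - \<Sum>U \<in> int_span C"
  shows "T = U"
proof -
  \<comment> \<open>One inclusion suffices, since \<open>int_span C\<close> is closed under negation
    and the roles of \<open>T\<close> and \<open>U\<close> can be swapped.\<close>
  have sub: "A \<subseteq> B" if A: "A \<subseteq> S - C" and B: "B \<subseteq> S - C" and AB: "\<Sum>A - \<Sum>B \<in> int_span C" for A B
  proof
    fix x assume x: "x \<in> A"
    show "x \<in> B"
    proof (rule ccontr)
      assume xB: "x \<notin> B"
      let ?X = "int_module.span (S - {x})"
      have "finite A"
        using A C(2) by (rule finite_subset)
      then have "\<Sum>A = x + \<Sum>(A - {x})"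
        using x by (simp add: sum.remove)
      \<comment> \<open>None of the three terms involves \<open>x\<close>: it is not in
        \<open>C\<close>, not in \<open>B\<close>, and removed from \<open>A\<close>.\<close>
      then have eq: "x = (\<Sum>A - \<Sum>B) + \<Sum>B - \<Sum>(A - {x})"
        by simp
      have "\<Sum>A - \<Sum>B \<in> ?X"
        using AB x A C(1) int_module.span_mono[of C "S - {x}"] by (auto simp: int_span_def)
      moreover have "\<Sum>B \<in> ?X" "\<Sum>(A - {x}) \<in> ?X"
        by (rule int_module.span_sum, rule int_module.span_base, use A B xB in blast)+
      ultimately have "(\<Sum>A - \<Sum>B) + \<Sum>B - \<Sum>(A - {x}) \<in> ?X"
        by (rule int_module.span_diff[OF int_module.span_add])
      then have "x \<in> ?X"
        by (simp only: eq[symmetric])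
      then have "S \<subseteq> ?X"
        using int_module.span_superset[of "S - {x}"] by blast
      then have "int_span S \<subseteq> int_span (S - {x})"
        unfolding int_span_def by (rule int_module.span_minimal) (rule int_module.subspace_span)
      moreover have "S - {x} \<subset> S"
        using x A by blast
      ultimately show False
        using S by (auto simp: minimal_generating_system_def)
    qed
  qed
  have "- (\<Sum>T - \<Sum>U) \<in> int_span C"
    using TU unfolding int_span_def by (rule int_module.span_neg)
  then show ?thesis
    using sub[OF T U TU] sub[OF U T] by simp
qed

theorem mainTheorem1:
  fixes L S :: "'a::euclidean_space set" and M B :: real
  assumes "is_lattice L" and "full_rank L"
    and "M = lattice_minimum L"
    and "S \<subseteq> L" and "minimal_generating_system S L"
    and "\<forall>x\<in>S. norm x \<le> B"
  shows "finite S \<and>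
    real (card S) \<le> real DIM('a) + log 2 (fact DIM('a) * (B / M) ^ DIM('a))"
proof
  let ?n = "DIM('a)"
  \<comment> \<open>Finiteness makes the cardinality bound meaningful, as \<open>card\<close> of an
    infinite set is 0.\<close>
  have "L \<inter> cball 0 B \<supseteq> S"
    using assms(4,6) by auto
  then show finS: "finite S"
    using finite_lattice_Int_bounded[OF assms(1)] by (meson bounded_cball finite_subset)
  have subL: "int_module.subspace L"
    using assms(1) by (simp add: is_lattice_def)
  have "L \<subseteq> span S"
  proof -
    have "int_span S \<subseteq> span S"
      unfolding int_span_def
      by (rule int_module.span_minimal)
        (auto simp: span_superset int_module.subspace_def span_zero span_add span_scale)
    then show ?thesis
      using assms(5) by (simp add: minimal_generating_system_def generating_system_def)
  qed
  then have spS: "span S = UNIV"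
    using assms(2) by (metis full_rank_def span_mono span_span top.extremum_uniqueI)
  \<comment> \<open>A basis chosen inside \<open>S\<close> inherits the norm bound \<open>B\<close>,
    and minimality of \<open>S\<close> controls the remaining vectors.\<close>
  obtain C where C: "C \<subseteq> S" "independent C" "S \<subseteq> span C"
    using maximal_independent_subset .
  have spC: "span C = UNIV"
    using C(3) spS by (metis span_mono span_span top.extremum_uniqueI)
  have cC: "card C = ?n"
    using C(2) spC by (metis basis_card_eq_dim dim_UNIV span_UNIV dim_eq_card)
  \<comment> \<open>The dimension is positive, so the basis has an element. It is a nonzero lattice
    vector of norm at most \<open>B\<close>, which makes \<open>M\<close> and \<open>B\<close>
    positive, as the logarithm requires.\<close>
  obtain c where c: "c \<in> C"
    using cC by fastforce
  then have "c \<noteq> 0"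
    using C(2) dependent_zero by blast
  have cL: "c \<in> L" "norm c \<le> B"
    using c C(1) assms(4,6) by auto
  have M: "0 < M" "\<And>x. x \<in> L \<Longrightarrow> x \<noteq> 0 \<Longrightarrow> M \<le> norm x"
    using lattice_minimum_le_norm[OF assms(1)] cL \<open>c \<noteq> 0\<close> unfolding assms(3) by blast+
  have B: "0 < B"
    using cL(2) \<open>c \<noteq> 0\<close> by (meson less_le_trans zero_less_norm_iff)
  define m where "m = card (S - C)"
  have cS: "card S = ?n + m"
    unfolding m_def cC[symmetric] using finS C(1)
    by (metis card_Diff_subset card_mono finite_subset le_add_diff_inverse)
  have inc: "T = U" if "T \<in> Pow (S - C)" "U \<in> Pow (S - C)" "\<Sum>T - \<Sum>U \<in> int_span C" for T U
    using subset_sums_incongruent[OF assms(5) C(1), of T U] that finS by simp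
  \<comment> \<open>Equal sums differ by 0, an element of \<open>int_span C\<close>, so distinct
    subsets give distinct lattice points.\<close>
  have "inj_on Sum (Pow (S - C))"
    by (rule inj_onI) (use inc in \<open>auto simp: int_span_def int_module.span_zero\<close>)
  then have "card (Sum ` Pow (S - C)) = 2 ^ m"
    using finS by (simp add: card_image card_Pow m_def)
  moreover have "card (Sum ` Pow (S - C)) * (unit_ball_vol (real ?n) * (M / 2) ^ ?n) \<le> B ^ ?n"
  proof (rule incongruent_card_bound[where C = C, OF assms(1) M])
    show "Sum ` Pow (S - C) \<subseteq> L"
      using assms(4) by (auto intro!: int_module.subspace_sum[OF subL])
    show "\<And>p q. \<lbrakk>p \<in> Sum ` Pow (S - C); q \<in> Sum ` Pow (S - C); p - q \<in> int_span C\<rbrakk> \<Longrightarrow> p = q"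
      using inc by blast
  qed (use C spC assms(4,6) finS in auto)
  ultimately have vol: "2 ^ m * (unit_ball_vol (real ?n) * (M / 2) ^ ?n) \<le> B ^ ?n"
    by simp
  have "2 ^ m * (2 ^ ?n / fact ?n * (M / 2) ^ ?n) \<le> 2 ^ m * (unit_ball_vol (real ?n) * (M / 2) ^ ?n)"
    using M(1) by (intro mult_left_mono mult_right_mono unit_ball_vol_ge) auto
  with vol have "2 ^ m * (2 ^ ?n / fact ?n * (M / 2) ^ ?n) \<le> B ^ ?n"
    by linarith
  \<comment> \<open>The \<open>2 ^ n\<close> in the ball estimate cancels the denominator of
    \<open>(M / 2) ^ n\<close>, which leaves \<open>M ^ n / fact n\<close>.\<close>
  then have "2 ^ m \<le> fact ?n * (B / M) ^ ?n"
    using M(1) by (simp add: power_divide field_simps)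
  then have "log 2 (2 ^ m) \<le> log 2 (fact ?n * (B / M) ^ ?n)"
    using B M(1) by (subst log_le_cancel_iff) auto
  then show "real (card S) \<le> real ?n + log 2 (fact ?n * (B / M) ^ ?n)"
    by (simp add: cS log_nat_power)
qed

end
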